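(* Let $(X,d)$ be a complete controlled rectangular metric space with control function $\alpha: X\times X\to[1,+\infty[$, and let $T:X\to X$ be a self-mapping. Suppose there exist $\lambda,\beta\in\,]0,1[$ with $\lambda+\beta<1$ such that for all $x,y\in X$, $$d(Tx,Ty)\leq \lambda\, d(x,y)+\beta\,\frac{d(x,Tx)\,d(y,Ty)}{1+d(x,y)}.$$ Let $x_0\in X$ and put $x_n=T^n x_0$ for $n\in\mathbb{N}$. Suppose that $$\sup_{m\geq 1}\ \lim_{i\to\infty}\ \alpha(x_{i+1},x_m)\,\frac{\alpha(x_{i+1},x_{i+2})+\alpha(x_{i+2},x_{i+3})}{\alpha(x_i,x_{i+1})+\alpha(x_{i+1},x_{i+2})}<\frac{1}{(\beta+\lambda)^2}.$$ Assume moreover that for every $x\in X$ the limits $$\lim_{n\to+\infty}\alpha(x_n,x),\qquad \lim_{n\to+\infty}\alpha(x,x_n),\qquad \lim_{n,m\to+\infty,\ n\neq m}\alpha(x_n,x_m)$$ exist and are finite, and that for every $x\in X$ $$\lim_{n,m\to+\infty,\ n\neq m}\alpha(x_n,x_m)<\frac{1}{\beta+\lambda},\qquad \lim_{n\to+\infty}\alpha(x_n,x)<\frac{1}{\beta+\lambda}.$$ Then $T$ has a unique fixed point in $X$.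
   Context: Let $X$ be a non-empty set and $\alpha:X\times X\to[1,+\infty[$ a function. A function $d:X\times X\to[0,+\infty[$ is called a controlled rectangular metric (with control function $\alpha$), and $(X,d)$ a controlled rectangular metric space, if: ($d_1$) for all $x,y\in X$, $d(x,y)=0$ if and only if $x=y$; ($d_2$) for all $x,y\in X$, $d(x,y)=d(y,x)$; ($d_3$) for all pairwise distinct $x,y,u,v\in X$, $d(x,y)\leq\alpha(x,u)d(x,u)+\alpha(u,v)d(u,v)+\alpha(v,y)d(v,y)$. (The function $\alpha$ is not assumed symmetric.) A sequence $\{x_n\}$ in $X$ converges to $x\in X$ if $\lim_{n\to\infty}d(x_n,x)=0$; it is Cauchy if for every $\varepsilon>0$ there is a positive integer $N$ such that $d(x_n,x_m)<\varepsilon$ for all $n,m\geq N$. The space $(X,d)$ is complete if every Cauchy sequence in $X$ converges to some point of $X$. *)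

theory Defs
  imports Complex_Main "HOL-Library.Extended_Real" "HOL-Library.FuncSet"
begin

locale controlled_rectangular_metric_space =
  fixes X :: "'a set" and \<alpha> :: "'a \<Rightarrow> 'a \<Rightarrow> real" and d :: "'a \<Rightarrow> 'a \<Rightarrow> real"
  assumes nonempty: "X \<noteq> {}"
    and control_ge_1: "\<lbrakk>x \<in> X; y \<in> X\<rbrakk> \<Longrightarrow> 1 \<le> \<alpha> x y"
    and nonneg: "\<lbrakk>x \<in> X; y \<in> X\<rbrakk> \<Longrightarrow> 0 \<le> d x y"
    and zero_iff: "\<lbrakk>x \<in> X; y \<in> X\<rbrakk> \<Longrightarrow> d x y = 0 \<longleftrightarrow> x = y"
    and commute: "\<lbrakk>x \<in> X; y \<in> X\<rbrakk> \<Longrightarrow> d x y = d y x"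
    and rectangular: "\<lbrakk>x \<in> X; y \<in> X; u \<in> X; v \<in> X; distinct [x, y, u, v]\<rbrakk>
      \<Longrightarrow> d x y \<le> \<alpha> x u * d x u + \<alpha> u v * d u v + \<alpha> v y * d v y"
begin

definition converges_to :: "(nat \<Rightarrow> 'a) \<Rightarrow> 'a \<Rightarrow> bool" where
  "converges_to s x \<longleftrightarrow> range s \<subseteq> X \<and> x \<in> X \<and> (\<lambda>n. d (s n) x) \<longlonglongrightarrow> 0"

definition Cauchy_seq :: "(nat \<Rightarrow> 'a) \<Rightarrow> bool" where
  "Cauchy_seq s \<longleftrightarrow> range s \<subseteq> X \<and>
    (\<forall>\<epsilon>>0. \<exists>N>0. \<forall>n\<ge>N. \<forall>m\<ge>N. d (s n) (s m) < \<epsilon>)"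

definition complete_space :: bool where
  "complete_space \<longleftrightarrow> (\<forall>s. Cauchy_seq s \<longrightarrow> (\<exists>x. converges_to s x))"

end

text \<open>The filter of the double limit as \<open>n, m \<rightarrow> \<infinity>\<close> with \<open>n \<noteq> m\<close>:
  both indices tend to infinity independently, staying off the diagonal.\<close>

definition offdiag_sequentially :: "(nat \<times> nat) filter" where
  "offdiag_sequentially =
    inf (sequentially \<times>\<^sub>F sequentially) (principal {(n, m). n \<noteq> m})"

lemma eventually_offdiag_sequentially:
  "eventually P offdiag_sequentially \<longleftrightarrow> (\<exists>N. \<forall>n\<ge>N. \<forall>m\<ge>N. n \<noteq> m \<longrightarrow> P (n, m))"
  unfolding offdiag_sequentially_def eventually_inf_principal eventually_prod_sequentially
  by auto

text \<open>So \<open>Lim offdiag_sequentially\<close> is single-valued.\<close>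

lemma offdiag_sequentially_neq_bot: "offdiag_sequentially \<noteq> bot"
proof
  assume "offdiag_sequentially = bot"
  then have "eventually (\<lambda>_. False) offdiag_sequentially" by simp
  then obtain N :: nat where "\<forall>n\<ge>N. \<forall>m\<ge>N. n = m"
    unfolding eventually_offdiag_sequentially by auto
  then have "N = Suc N" by (meson le_Suc_eq order_refl)
  then show False by simp
qed

end

theory Submission
  imports Defs
begin

text \<open>The proof rests on two observations about an orbit \<open>x\<close> of \<open>T\<close>.

  First, the rational term is harmless along the orbit: \<open>d y (T y) / (1 + d y (T y)) \<le> 1\<close>, so
  the contraction inequality bounds the step \<open>d (T y) (T (T y))\<close> by
  \<open>lam / (1 - \<beta>) \<le> lam + \<beta>\<close> times the preceding step. Hence the steps tend to \<open>0\<close>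
  geometrically, and unless the orbit hits a fixed point its terms are pairwise distinct, because
  the steps strictly decrease; this is what makes the rectangular inequality applicable.

  Second, the Cauchy property comes from a single quadrilateral, with vertices \<open>x n\<close>,
  \<open>x (n + 1)\<close>, \<open>x (m + 1)\<close>, \<open>x m\<close>. The rectangular inequality bounds \<open>d (x n) (x m)\<close> by the
  weighted sum of two steps and of the distance \<open>d (x (n + 1)) (x (m + 1))\<close>, and the contraction
  bounds this distance by \<open>lam * d (x n) (x m)\<close> up to a product of two
  steps. Far out the three control values are at most some \<open>c < 1 / (lam + \<beta>)\<close>, so
  \<open>c * lam < 1\<close> and the term \<open>c * lam * d (x n) (x m)\<close> can be absorbed on the left. What remains
  on the right consists of steps, which tend to \<open>0\<close> (\<open>orbit_Cauchy\<close>).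

  If \<open>p\<close> is the limit of the orbit, then the contraction shows that the orbit also tends to
  \<open>T p\<close>. Limits need not be unique in such a space, but they are for an injective sequence with
  vanishing steps along which the control function stays bounded (\<open>limit_unique\<close>); so
  \<open>T p = p\<close>. Uniqueness of the fixed point is immediate, since the rational term vanishes at fixed
  points.\<close>

section \<open>Uniqueness of limits\<close>

context controlled_rectangular_metric_space
begin

text \<open>The quadrilateral \<open>p\<close>, \<open>s n\<close>, \<open>s (n + 1)\<close>, \<open>q\<close> shows that \<open>d p q\<close> is bounded by a null
  sequence. Injectivity of \<open>s\<close> ensures that its vertices are distinct for large \<open>n\<close>.\<close>

lemma limit_unique:
  assumes p: "converges_to s p" and q: "converges_to s q" and inj: "inj s"
    and steps: "(\<lambda>n. d (s n) (s (Suc n))) \<longlonglongrightarrow> 0"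
    and bound_p: "\<forall>\<^sub>F n in sequentially. \<alpha> p (s n) \<le> A"
    and bound_s: "\<forall>\<^sub>F n in sequentially. \<alpha> (s n) (s (Suc n)) \<le> B"
    and bound_q: "\<forall>\<^sub>F n in sequentially. \<alpha> (s n) q \<le> C"
  shows "p = q"
proof (rule ccontr)
  assume "p \<noteq> q"
  have X: "p \<in> X" "q \<in> X" and sX: "\<And>n. s n \<in> X"
    using p q unfolding converges_to_def by auto
  have avoid: "\<forall>\<^sub>F n in sequentially. s n \<noteq> a" for a
  proof -
    have "finite (s -` {a})"
      using inj by (simp add: finite_vimageI)
    then have "\<forall>\<^sub>F n in cofinite. s n \<noteq> a"
      by (simp add: eventually_cofinite vimage_def)
    then show ?thesis
      by (simp add: cofinite_eq_sequentially)
  qed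
  have lim_p: "(\<lambda>n. d p (s n)) \<longlonglongrightarrow> 0"
    using p commute[OF X(1) sX] unfolding converges_to_def by simp
  have lim_q: "(\<lambda>n. d (s (Suc n)) q) \<longlonglongrightarrow> 0"
    using q unfolding converges_to_def by (auto dest: LIMSEQ_Suc)
  have "\<forall>\<^sub>F n in sequentially. d p q \<le> A * d p (s n) + B * d (s n) (s (Suc n)) + C * d (s (Suc n)) q"
    using eventually_all_ge_at_top[OF avoid[of p]]
      eventually_all_ge_at_top[OF avoid[of q]] bound_p bound_s eventually_all_ge_at_top[OF bound_q]
  proof eventually_elim
    case (elim n)
    have "\<alpha> (s (Suc n)) q \<le> C"
      using elim by simp
    have "s n \<noteq> p" "s n \<noteq> q" "s (Suc n) \<noteq> p" "s (Suc n) \<noteq> q"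
      using elim le_SucI[OF order_refl] by blast+
    moreover have "s n \<noteq> s (Suc n)"
      using inj by (auto dest: injD)
    ultimately have "distinct [p, q, s n, s (Suc n)]"
      using \<open>p \<noteq> q\<close> by auto
    then have "d p q \<le> \<alpha> p (s n) * d p (s n) + \<alpha> (s n) (s (Suc n)) * d (s n) (s (Suc n))
        + \<alpha> (s (Suc n)) q * d (s (Suc n)) q"
      using rectangular X sX by blast
    also have "\<dots> \<le> A * d p (s n) + B * d (s n) (s (Suc n)) + C * d (s (Suc n)) q"
      using elim \<open>\<alpha> (s (Suc n)) q \<le> C\<close> X sX
      by (intro add_mono mult_right_mono nonneg) auto
    finally show ?case .
  qed
  moreover have "(\<lambda>n. A * d p (s n) + B * d (s n) (s (Suc n)) + C * d (s (Suc n)) q) \<longlonglongrightarrow> 0"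
    using tendsto_add[OF tendsto_add[OF tendsto_mult_left[OF lim_p, of A]
      tendsto_mult_left[OF steps, of B]] tendsto_mult_left[OF lim_q, of C]] by simp
  ultimately have "d p q \<le> 0"
    using tendsto_lowerbound trivial_limit_sequentially by blast
  then show False
    using nonneg[of p q] zero_iff[of p q] X \<open>p \<noteq> q\<close> by simp
qed

end

section \<open>Contractions of rational type\<close>

locale rational_contraction = controlled_rectangular_metric_space X \<alpha> d
  for X :: "'a set" and \<alpha> d +
  fixes T :: "'a \<Rightarrow> 'a" and lam \<beta> :: real
  assumes self_map: "T \<in> X \<rightarrow> X"
    and lam_pos: "0 < lam" and beta_pos: "0 < \<beta>" and sum_lt_1: "lam + \<beta> < 1"
    and contraction: "\<lbrakk>y \<in> X; z \<in> X\<rbrakk> \<Longrightarrow>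
      d (T y) (T z) \<le> lam * d y z + \<beta> * (d y (T y) * d z (T z) / (1 + d y z))"
begin

lemma T_in: "y \<in> X \<Longrightarrow> T y \<in> X"
  using self_map by auto

lemma iterate_in: "y \<in> X \<Longrightarrow> (T ^^ n) y \<in> X"
  by (induction n) (auto intro: T_in)

lemma contraction_product:
  assumes "y \<in> X" "z \<in> X"
  shows "d (T y) (T z) \<le> lam * d y z + \<beta> * (d y (T y) * d z (T z))"
proof -
  have "d y (T y) * d z (T z) / (1 + d y z) \<le> d y (T y) * d z (T z) / 1"
    using assms by (intro divide_left_mono) (auto intro!: mult_nonneg_nonneg add_pos_nonneg nonneg T_in)
  then have "\<beta> * (d y (T y) * d z (T z) / (1 + d y z)) \<le> \<beta> * (d y (T y) * d z (T z))"
    using beta_pos by (intro mult_left_mono) auto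
  then show ?thesis
    using contraction[OF assms] by linarith
qed

text \<open>With \<open>a = d y (T y)\<close> and \<open>b = d (T y) (T (T y))\<close>, the contraction reads
  \<open>b \<le> lam * a + \<beta> * b * (a / (1 + a))\<close>, so \<open>(1 - \<beta>) * b \<le> lam * a\<close>; and
  \<open>lam \<le> (1 - \<beta>) * (lam + \<beta>)\<close> is equivalent to \<open>lam + \<beta> \<le> 1\<close>.\<close>

lemma step_shrinks:
  assumes y: "y \<in> X"
  shows "d (T y) (T (T y)) \<le> (lam + \<beta>) * d y (T y)"
proof -
  define a b where "a = d y (T y)" and "b = d (T y) (T (T y))"
  have a: "0 \<le> a" and b: "0 \<le> b"
    using y by (auto simp: a_def b_def intro: nonneg T_in)
  have "a * b / (1 + a) \<le> b"
    using a b by (simp add: field_simps)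
  then have "\<beta> * (a * b / (1 + a)) \<le> \<beta> * b"
    using beta_pos by (intro mult_left_mono) auto
  then have "(1 - \<beta>) * b \<le> lam * a"
    using contraction[OF y T_in[OF y]] by (simp add: a_def b_def algebra_simps)
  also have "\<dots> \<le> ((1 - \<beta>) * (lam + \<beta>)) * a"
  proof (rule mult_right_mono[OF _ a])
    have "0 \<le> \<beta> * (1 - (lam + \<beta>))"
      using beta_pos sum_lt_1 by simp
    then show "lam \<le> (1 - \<beta>) * (lam + \<beta>)"
      by (simp add: algebra_simps)
  qed
  finally have "(1 - \<beta>) * b \<le> (1 - \<beta>) * ((lam + \<beta>) * a)"
    by (simp add: mult.assoc)
  moreover have "0 < 1 - \<beta>"
    using lam_pos sum_lt_1 by simp
  ultimately show ?thesis
    unfolding a_def b_def by simp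
qed

lemma step_decay:
  assumes "y \<in> X"
  shows "d ((T ^^ n) y) ((T ^^ Suc n) y) \<le> (lam + \<beta>) ^ n * d y (T y)"
proof (induction n)
  case (Suc n)
  have "d ((T ^^ Suc n) y) ((T ^^ Suc (Suc n)) y) \<le> (lam + \<beta>) * d ((T ^^ n) y) ((T ^^ Suc n) y)"
    using step_shrinks[OF iterate_in[OF assms]] by simp
  also have "\<dots> \<le> (lam + \<beta>) * ((lam + \<beta>) ^ n * d y (T y))"
    using Suc lam_pos beta_pos by (intro mult_left_mono) auto
  finally show ?case
    by (simp add: mult.assoc)
qed simp

lemma steps_tendsto_0:
  assumes y: "y \<in> X"
  shows "(\<lambda>n. d ((T ^^ n) y) ((T ^^ Suc n) y)) \<longlonglongrightarrow> 0"
proof (rule tendsto_sandwich)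
  show "\<forall>\<^sub>F n in sequentially. 0 \<le> d ((T ^^ n) y) ((T ^^ Suc n) y)"
    using iterate_in[OF y] by (intro always_eventually allI nonneg)
  show "\<forall>\<^sub>F n in sequentially.
      d ((T ^^ n) y) ((T ^^ Suc n) y) \<le> (lam + \<beta>) ^ n * d y (T y)"
    using step_decay[OF y] by (intro always_eventually allI)
  show "(\<lambda>n. (lam + \<beta>) ^ n * d y (T y)) \<longlonglongrightarrow> 0"
    using lam_pos beta_pos sum_lt_1 by (intro tendsto_mult_left_zero LIMSEQ_power_zero) simp
qed simp

text \<open>A repetition on the orbit would make two of its steps equal, although a later step is
  strictly smaller than an earlier positive one.\<close>

lemma orbit_inj:
  assumes y: "y \<in> X" and no_fixed: "\<And>n. T ((T ^^ n) y) \<noteq> (T ^^ n) y"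
  shows "inj (\<lambda>n. (T ^^ n) y)"
proof (rule linorder_injI)
  fix n m :: nat
  assume "n < m"
  then obtain j where m: "m = Suc j + n"
    using less_imp_Suc_add by (metis add.commute add_Suc_right)
  define z where "z = (T ^^ n) y"
  have z: "z \<in> X"
    using iterate_in[OF y] by (simp add: z_def)
  have pos: "0 < d z (T z)"
    using nonneg[OF z T_in[OF z]] zero_iff[OF z T_in[OF z]] no_fixed[of n]
    by (auto simp: z_def order_less_le)
  have "(lam + \<beta>) ^ Suc j < 1"
    using lam_pos beta_pos sum_lt_1 by (intro power_Suc_less_one) auto
  then have "(lam + \<beta>) ^ Suc j * d z (T z) < d z (T z)"
    using pos by simp
  then have "d ((T ^^ Suc j) z) ((T ^^ Suc (Suc j)) z) < d z (T z)"
    using step_decay[OF z, of "Suc j"] by linarith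
  then have "(T ^^ Suc j) z \<noteq> z"
    by auto
  then show "(T ^^ n) y \<noteq> (T ^^ m) y"
    unfolding m z_def funpow_add by auto
qed

section \<open>Convergence of the orbit to a fixed point\<close>

text \<open>Going from \<open>x n\<close> to \<open>x m\<close> through their successors bounds \<open>d (x n) (x m)\<close> by \<open>c * lam\<close>
  times itself plus multiples of steps, and \<open>c * lam < 1\<close> allows to solve for it. The quadrilateral
  \<open>x n\<close>, \<open>x (n + 1)\<close>, \<open>x (m + 1)\<close>, \<open>x m\<close> is degenerate when \<open>n\<close> and \<open>m\<close>
  differ by at most \<open>1\<close>; then \<open>d (x n) (x m)\<close> is \<open>0\<close> or itself a step.\<close>

lemma orbit_Cauchy:
  assumes y: "y \<in> X" and x: "\<And>n. x n = (T ^^ n) y" and inj: "inj x"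
    and bound: "\<forall>\<^sub>F (n, m) in offdiag_sequentially. \<alpha> (x n) (x m) \<le> c" and c: "c * lam < 1"
  shows "Cauchy_seq x"
  unfolding Cauchy_seq_def
proof (intro conjI allI impI)
  have X: "x n \<in> X" for n
    using iterate_in[OF y] x by simp
  show "range x \<subseteq> X"
    using X by auto
  have T_x: "T (x n) = x (Suc n)" for n
    by (simp add: x)
  obtain K where K: "\<And>n m. \<lbrakk>K \<le> n; K \<le> m; n \<noteq> m\<rbrakk> \<Longrightarrow> \<alpha> (x n) (x m) \<le> c"
    using bound unfolding eventually_offdiag_sequentially by auto
  have "1 \<le> c"
    using K[of K "Suc K"] control_ge_1[OF X X, of K "Suc K"] by simp
  fix \<epsilon> :: real
  assume \<epsilon>: "0 < \<epsilon>"
  \<comment> \<open>Steps below \<open>\<eta>\<close> make \<open>c * (step + step) + c * \<beta> * step * step\<close> smaller than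
    \<open>c * (2 + \<beta>) * \<eta> \<le> (1 - c * lam) * \<epsilon>\<close>; the bound \<open>1\<close> linearizes the product.\<close>
  define \<eta> where "\<eta> = Min {1, \<epsilon>, (1 - c * lam) * \<epsilon> / (c * (2 + \<beta>))}"
  have \<eta>: "0 < \<eta>" "\<eta> \<le> 1" "\<eta> \<le> \<epsilon>" "\<eta> \<le> (1 - c * lam) * \<epsilon> / (c * (2 + \<beta>))"
    using \<epsilon> c \<open>1 \<le> c\<close> beta_pos by (auto simp: \<eta>_def)
  have "c * (2 + \<beta>) * \<eta> \<le> (1 - c * lam) * \<epsilon>"
    using \<eta>(4) \<open>1 \<le> c\<close> beta_pos by (simp add: pos_le_divide_eq mult.commute)
  have "(\<lambda>n. d (x n) (x (Suc n))) \<longlonglongrightarrow> 0"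
    using steps_tendsto_0[OF y] by (simp add: x)
  then have "\<forall>\<^sub>F n in sequentially. d (x n) (x (Suc n)) < \<eta>"
    using \<eta>(1) by (rule order_tendstoD)
  then obtain M where M: "\<And>n. M \<le> n \<Longrightarrow> d (x n) (x (Suc n)) < \<eta>"
    unfolding eventually_sequentially by auto
  have close: "d (x n) (x m) < \<epsilon>" if n: "Suc (K + M) \<le> n" and m: "Suc (K + M) \<le> m" for n m
  proof -
    define a b e where "a = d (x n) (x (Suc n))" and "b = d (x m) (x (Suc m))"
      and "e = d (x n) (x m)"
    have a: "0 \<le> a" "a < \<eta>" and b: "0 \<le> b" "b < \<eta>"
      using M[of n] M[of m] n m X by (auto simp: a_def b_def intro: nonneg)
    consider "n = m" | "m = Suc n" | "n = Suc m" | "n \<noteq> m" "m \<noteq> Suc n" "n \<noteq> Suc m"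
      by blast
    then show ?thesis
    proof cases
      case 1
      then show ?thesis
        using zero_iff[OF X X, of n n] \<epsilon> by simp
    next
      case 2
      then show ?thesis
        using a \<eta> by (simp add: a_def)
    next
      case 3
      then show ?thesis
        using b \<eta> commute[OF X X, of n m] by (simp add: b_def)
    next
      case 4
      then have "distinct [x n, x m, x (Suc n), x (Suc m)]"
        using inj by (auto dest: injD)
      then have "e \<le> \<alpha> (x n) (x (Suc n)) * d (x n) (x (Suc n))
          + \<alpha> (x (Suc n)) (x (Suc m)) * d (x (Suc n)) (x (Suc m))
          + \<alpha> (x (Suc m)) (x m) * d (x (Suc m)) (x m)"
        unfolding e_def using rectangular X by blast
      also have "\<dots> \<le> c * a + c * (lam * e + \<beta> * (a * b)) + c * b"
        using K[of n "Suc n"] K[of "Suc n" "Suc m"] K[of "Suc m" m] 4 n m \<open>1 \<le> c\<close>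
          contraction_product[OF X X, of n m] commute[OF X X, of "Suc m" m]
        by (intro add_mono mult_mono) (auto simp: a_def b_def e_def T_x intro: nonneg X)
      finally have "(1 - c * lam) * e \<le> c * (a + b + \<beta> * (a * b))"
        by (simp add: algebra_simps)
      also have "\<dots> < c * ((2 + \<beta>) * \<eta>)"
      proof -
        have "a * b \<le> \<eta> * 1"
          using a b \<eta> by (intro mult_mono) auto
        then have "\<beta> * (a * b) \<le> \<beta> * \<eta>"
          using beta_pos by simp
        then have "a + b + \<beta> * (a * b) < (2 + \<beta>) * \<eta>"
          using a b by (simp add: algebra_simps)
        then show ?thesis
          using \<open>1 \<le> c\<close> by simp
      qed
      also have "\<dots> \<le> (1 - c * lam) * \<epsilon>"
        using \<open>c * (2 + \<beta>) * \<eta> \<le> (1 - c * lam) * \<epsilon>\<close> by (simp add: mult.assoc)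
      finally show ?thesis
        using c by (simp add: e_def)
    qed
  qed
  show "\<exists>N>0. \<forall>n\<ge>N. \<forall>m\<ge>N. d (x n) (x m) < \<epsilon>"
    using close by (intro exI[of _ "Suc (K + M)"]) auto
qed

lemma orbit_converges_to_image:
  assumes y: "y \<in> X" and p: "converges_to (\<lambda>n. (T ^^ n) y) p"
  shows "converges_to (\<lambda>n. (T ^^ n) y) (T p)"
proof -
  let ?x = "\<lambda>n. (T ^^ n) y"
  have pX: "p \<in> X" and X: "?x n \<in> X" and lim: "(\<lambda>n. d (?x n) p) \<longlonglongrightarrow> 0" for n
    using p unfolding converges_to_def by auto
  have "(\<lambda>n. d (?x (Suc n)) (T p)) \<longlonglongrightarrow> 0"
  proof (rule tendsto_sandwich)
    show "\<forall>\<^sub>F n in sequentially. 0 \<le> d (?x (Suc n)) (T p)"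
      using X pX by (intro always_eventually allI nonneg T_in)
    show "\<forall>\<^sub>F n in sequentially. d (?x (Suc n)) (T p)
        \<le> lam * d (?x n) p + \<beta> * (d (?x n) (?x (Suc n)) * d p (T p))"
      using contraction_product[OF X pX] by (intro always_eventually allI) simp
    show "(\<lambda>n. lam * d (?x n) p + \<beta> * (d (?x n) (?x (Suc n)) * d p (T p))) \<longlonglongrightarrow> 0"
      using lim steps_tendsto_0[OF y]
      by (intro tendsto_add_zero tendsto_mult_right_zero tendsto_mult_left_zero)
  qed simp
  then have "(\<lambda>n. d (?x n) (T p)) \<longlonglongrightarrow> 0"
    by (rule LIMSEQ_imp_Suc)
  then show ?thesis
    using X T_in[OF pX] unfolding converges_to_def by auto
qed

lemma fixed_point_unique:
  assumes "p \<in> X" "T p = p" "q \<in> X" "T q = q"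
  shows "p = q"
proof -
  have "d p p = 0"
    using assms zero_iff by simp
  then have "d p q \<le> lam * d p q"
    using contraction[of p q] assms by simp
  then have "(1 - lam) * d p q \<le> 0"
    by (simp add: algebra_simps)
  then have "d p q \<le> 0"
    using beta_pos sum_lt_1 by (simp add: mult_le_0_iff)
  then show ?thesis
    using nonneg[of p q] zero_iff[of p q] assms by simp
qed

end

section \<open>The fixed point theorem\<close>

lemma convergent_eventually_bounded_above:
  fixes f :: "nat \<Rightarrow> real"
  assumes "convergent f"
  shows "\<exists>B. \<forall>\<^sub>F n in sequentially. f n \<le> B"
proof -
  obtain B where "\<And>n. norm (f n) \<le> B"
    using convergent_imp_Bseq[OF assms] by (auto simp: Bseq_def)
  then show ?thesis
    by (intro exI[of _ B] always_eventually) (auto dest: abs_le_D1)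
qed

theorem theorem2p10:
  fixes X :: "'a set" and \<alpha> d :: "'a \<Rightarrow> 'a \<Rightarrow> real" and T :: "'a \<Rightarrow> 'a"
    and lam \<beta> :: real and x0 :: 'a and x :: "nat \<Rightarrow> 'a"
  assumes space: "controlled_rectangular_metric_space X \<alpha> d"
    and complete: "controlled_rectangular_metric_space.complete_space X d"
    and self_map: "T \<in> X \<rightarrow> X"
    and lam: "0 < lam" "lam < 1" and beta: "0 < \<beta>" "\<beta> < 1" and sum_lt_1: "lam + \<beta> < 1"
    and contraction: "\<And>y z. \<lbrakk>y \<in> X; z \<in> X\<rbrakk> \<Longrightarrow>
      d (T y) (T z) \<le> lam * d y z + \<beta> * (d y (T y) * d z (T z) / (1 + d y z))"
    and x0: "x0 \<in> X" and x_def: "\<And>n. x n = (T ^^ n) x0"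
    and ratio_limit_exists: "\<And>m. m \<ge> 1 \<Longrightarrow> convergent (\<lambda>i. ereal (\<alpha> (x (i+1)) (x m) *
      ((\<alpha> (x (i+1)) (x (i+2)) + \<alpha> (x (i+2)) (x (i+3))) /
       (\<alpha> (x i) (x (i+1)) + \<alpha> (x (i+1)) (x (i+2))))))"
    and ratio_sup: "(SUP m\<in>{1..}. lim (\<lambda>i. ereal (\<alpha> (x (i+1)) (x m) *
      ((\<alpha> (x (i+1)) (x (i+2)) + \<alpha> (x (i+2)) (x (i+3))) /
       (\<alpha> (x i) (x (i+1)) + \<alpha> (x (i+1)) (x (i+2))))))) < ereal (1 / (\<beta> + lam)^2)"
    and left_limit_exists: "\<And>y. y \<in> X \<Longrightarrow> convergent (\<lambda>n. \<alpha> (x n) y)"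
    and right_limit_exists: "\<And>y. y \<in> X \<Longrightarrow> convergent (\<lambda>n. \<alpha> y (x n))"
    and double_limit_exists:
      "\<exists>l. ((\<lambda>(n, m). \<alpha> (x n) (x m)) \<longlongrightarrow> l) offdiag_sequentially"
    and double_limit_lt: "Lim offdiag_sequentially (\<lambda>(n, m). \<alpha> (x n) (x m)) < 1 / (\<beta> + lam)"
    and left_limit_lt: "\<And>y. y \<in> X \<Longrightarrow> lim (\<lambda>n. \<alpha> (x n) y) < 1 / (\<beta> + lam)"
  shows "\<exists>!p. p \<in> X \<and> T p = p"
proof (rule ex_ex1I)
  interpret rational_contraction X \<alpha> d T lam \<beta>
    using space self_map lam(1) beta(1) sum_lt_1 contraction
    by (intro rational_contraction.intro rational_contraction_axioms.intro)
  show "p = q" if "p \<in> X \<and> T p = p" "q \<in> X \<and> T q = q" for p q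
    using fixed_point_unique that by blast
  show "\<exists>p. p \<in> X \<and> T p = p"
  proof (cases "\<exists>n. T (x n) = x n")
    case True
    then show ?thesis
      using iterate_in[OF x0] x_def by metis
  next
    case False
    have x_eq: "x = (\<lambda>n. (T ^^ n) x0)"
      using x_def by blast
    have inj: "inj x"
      using orbit_inj[OF x0] False unfolding x_eq by blast
    obtain l where l: "((\<lambda>(n, m). \<alpha> (x n) (x m)) \<longlongrightarrow> l) offdiag_sequentially"
      using double_limit_exists by blast
    then have "l < 1 / (\<beta> + lam)"
      using double_limit_lt tendsto_Lim[OF offdiag_sequentially_neq_bot l] by simp
    then obtain c where c: "l < c" "c < 1 / (\<beta> + lam)"
      using dense by blast
    have bound: "\<forall>\<^sub>F (n, m) in offdiag_sequentially. \<alpha> (x n) (x m) \<le> c"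
      using order_tendstoD(2)[OF l c(1)] by (rule eventually_mono) auto
    have "c * lam < 1"
    proof -
      have "c * (\<beta> + lam) < 1"
        using c(2) lam beta by (simp add: pos_less_divide_eq)
      then show ?thesis
        using lam beta mult_nonneg_nonneg[of c \<beta>] mult_nonpos_nonneg[of c lam]
        unfolding distrib_left by linarith
    qed
    then have "Cauchy_seq x"
      using orbit_Cauchy[OF x0 x_def inj bound] by blast
    then obtain p where p: "converges_to x p"
      using complete unfolding complete_space_def by blast
    then have Tp: "converges_to x (T p)"
      using orbit_converges_to_image[OF x0] unfolding x_eq by blast
    have X: "p \<in> X" "T p \<in> X"
      using p Tp unfolding converges_to_def by auto
    obtain A where A: "\<forall>\<^sub>F n in sequentially. \<alpha> p (x n) \<le> A"
      using convergent_eventually_bounded_above[OF right_limit_exists[OF X(1)]] by blast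
    obtain C where C: "\<forall>\<^sub>F n in sequentially. \<alpha> (x n) (T p) \<le> C"
      using convergent_eventually_bounded_above[OF left_limit_exists[OF X(2)]] by blast
    obtain N where N: "\<And>n m. \<lbrakk>N \<le> n; N \<le> m; n \<noteq> m\<rbrakk> \<Longrightarrow> \<alpha> (x n) (x m) \<le> c"
      using bound unfolding eventually_offdiag_sequentially by auto
    have "\<forall>\<^sub>F n in sequentially. \<alpha> (x n) (x (Suc n)) \<le> c"
      using N by (intro eventually_sequentiallyI[of N]) simp
    moreover have "(\<lambda>n. d (x n) (x (Suc n))) \<longlonglongrightarrow> 0"
      using steps_tendsto_0[OF x0] unfolding x_eq .
    ultimately have "p = T p"
      using limit_unique[OF p Tp inj] A C by blast
    then show ?thesis
      using X by auto
  qed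
qed

end
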